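(* Let $G=(V,E)$ be a finite graph (loops and multiple edges allowed). Then $$\omega_G(\beta):=\frac{\theta_G(\beta,2\sqrt{-1})}{(1-\beta)^{|E|-|V|}}$$ is a polynomial in $\beta$ with integer coefficients, i.e. $\omega_G(\beta)\in\mathbb{Z}[\beta]$.
   Context: Graphs are finite undirected multigraphs; loops and multiple edges are allowed. The degree of a vertex is the number of edge-ends at it (a loop counts twice). For $s\subset E$, $d_i(s)$ is the degree of vertex $i$ in the spanning subgraph $(V,s)$. The polynomials $f_n(x)$, $n\ge 0$, are defined by $f_0(x)=1$, $f_1(x)=0$, $f_{n+1}(x)=x f_n(x)+f_{n-1}(x)$ for $n\ge1$. The graph polynomial $\theta_G$ is $$\theta_G(\beta,\gamma):=\sum_{s\subset E}\beta^{|s|}\prod_{i\in V}f_{d_i(s)}(\gamma)\in\mathbb{Z}[\beta,\gamma].$$ *)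

theory Defs
  imports Complex_Main
    "HOL-Library.Multiset"
    "HOL-Computational_Algebra.Computational_Algebra"
begin

text \<open>
  An edge \<open>e\<close> carries the two-element multiset \<open>ends e\<close> of its end vertices, so a loop at \<open>v\<close>
  has \<open>ends e = {#v, v#}\<close>, and distinct edges may have the same ends.
\<close>

locale fin_multigraph =
  fixes V :: "'v set" and E :: "'e set" and ends :: "'e \<Rightarrow> 'v multiset"
  assumes finite_V: "finite V"
    and finite_E: "finite E"
    and size_ends: "e \<in> E \<Longrightarrow> size (ends e) = 2"
    and ends_in_V: "e \<in> E \<Longrightarrow> set_mset (ends e) \<subseteq> V"

definition deg_in :: "('e \<Rightarrow> 'v multiset) \<Rightarrow> 'e set \<Rightarrow> 'v \<Rightarrow> nat" where
  "deg_in ends s v = (\<Sum>e\<in>s. count (ends e) v)"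

fun f_poly :: "nat \<Rightarrow> int poly" where
  "f_poly 0 = 1"
| "f_poly (Suc 0) = 0"
| "f_poly (Suc (Suc n)) = [:0, 1:] * f_poly (Suc n) + f_poly n"

text \<open>
  The ring \<open>\<int>[\<beta>,\<gamma>]\<close> is represented as \<open>\<int>[\<gamma>][\<beta>]\<close>: the outer variable is \<open>\<beta>\<close>, and the
  coefficients are polynomials in \<open>\<gamma>\<close>.
\<close>

definition theta :: "'v set \<Rightarrow> 'e set \<Rightarrow> ('e \<Rightarrow> 'v multiset) \<Rightarrow> int poly poly" where
  "theta V E ends = (\<Sum>s\<in>Pow E. monom (\<Prod>v\<in>V. f_poly (deg_in ends s v)) (card s))"

definition subst_gamma :: "complex \<Rightarrow> int poly poly \<Rightarrow> complex poly" where
  "subst_gamma c P = map_poly (\<lambda>q. poly (map_poly of_int q) c) P"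

text \<open>
  The exponent \<open>\<bar>E\<bar> - \<bar>V\<bar>\<close> may be negative, so the quotient is formed in the field \<open>\<complex>(\<beta>)\<close>.
\<close>

definition omega :: "'v set \<Rightarrow> 'e set \<Rightarrow> ('e \<Rightarrow> 'v multiset) \<Rightarrow> complex poly fract" where
  "omega V E ends =
     to_fract (subst_gamma (2 * \<i>) (theta V E ends))
       / to_fract [:1, -1:] powi (int (card E) - int (card V))"

end

theory Submission
  imports Defs
begin

text \<open>
  At \<open>\<gamma> = 2\<i>\<close> the characteristic polynomial \<open>x\<^sup>2 - 2\<i>x - 1\<close> of the recursion for \<open>f\<^sub>n\<close> has the double
  root \<open>\<i>\<close>, so \<open>f\<^sub>n(2\<i>) = \<i>\<^sup>n (1 - n)\<close> (lemma \<open>poly_f_poly_double_root\<close>).  The degrees of the spanning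
  subgraph \<open>s\<close> add up to \<open>2\<bar>s\<bar>\<close>, so the powers of \<open>\<i>\<close> combine to \<open>(-1)\<close> to the power \<open>\<bar>s\<bar>\<close>, and
  \<open>\<theta>(\<beta>, 2\<i>)\<close> is the integer polynomial \<open>\<Sum>s\<subseteq>E. (-\<beta>)^\<bar>s\<bar> * (\<Prod>v\<in>V. 1 - d\<^sub>v(s))\<close>
  (lemma \<open>subst_gamma_theta\<close>).

  It remains to see that \<open>1 - \<beta>\<close> divides this sum at least \<open>\<bar>E\<bar> - \<bar>V\<bar>\<close> times.  Without the product
  over \<open>V\<close> the sum is \<open>(1 - \<beta>)^\<bar>E\<bar>\<close> by the binomial theorem.  Each degree \<open>d\<^sub>v(s)\<close> is a sum of
  contributions of the single edges of \<open>s\<close>; multiplying it out fixes at most one edge per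
  vertex to lie in \<open>s\<close>, and each fixed edge costs at most one factor \<open>1 - \<beta>\<close>
  (lemma \<open>power_dvd_subset_sum_prod\<close>).  The argument works over any commutative ring; applied in
  \<open>\<int>[\<beta>]\<close> it makes the quotient integral.  If \<open>\<bar>E\<bar> < \<bar>V\<bar>\<close>, the denominator is the inverse of a power
  of \<open>1 - \<beta>\<close> and there is nothing to divide.
\<close>

lemma sum_power_card_supersets:
  fixes x :: "'a :: comm_ring_1"
  assumes "finite E" "A \<subseteq> E"
  shows "(\<Sum>s | A \<subseteq> s \<and> s \<subseteq> E. x ^ card s) = x ^ card A * (1 + x) ^ (card E - card A)"
proof -
  have finA: "finite A"
    using assms finite_subset by blast
  have "(\<Sum>s | A \<subseteq> s \<and> s \<subseteq> E. x ^ card s) = (\<Sum>t\<in>Pow (E - A). x ^ card (A \<union> t))"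
    by (rule sum.reindex_bij_witness[where j = "\<lambda>s. s - A" and i = "\<lambda>t. A \<union> t"])
      (use assms in \<open>auto simp: Un_absorb1\<close>)
  also have "\<dots> = (\<Sum>t\<in>Pow (E - A). x ^ card A * x ^ card t)"
  proof (rule sum.cong)
    fix t assume "t \<in> Pow (E - A)"
    then have "finite t" "A \<inter> t = {}"
      using assms(1) finite_subset[of t E] by auto
    then show "x ^ card (A \<union> t) = x ^ card A * x ^ card t"
      using finA by (simp add: card_Un_disjoint power_add)
  qed simp
  also have "\<dots> = x ^ card A * (\<Prod>e\<in>E - A. x + 1)"
    using assms(1) by (subst prod_add) (simp_all add: sum_distrib_left)
  finally show ?thesis
    using assms finA by (simp add: card_Diff_subset add.commute)
qed

text \<open>
  The induction on \<open>V\<close> needs the sum over all \<open>s\<close> that contain a prescribed set \<open>A\<close>: the factor for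
  a new vertex turns the sum for \<open>A\<close> into a linear combination of itself and the sums for
  \<open>insert e A\<close>, and each of these loses at most one factor \<open>1 + x\<close>.
\<close>

lemma power_dvd_superset_sum_prod:
  fixes x :: "'a :: comm_ring_1" and c :: "'v \<Rightarrow> 'e \<Rightarrow> 'a"
  assumes "finite V" "finite E" "A \<subseteq> E"
  shows "(1 + x) ^ (card E - card A - card V) dvd
    (\<Sum>s | A \<subseteq> s \<and> s \<subseteq> E. x ^ card s * (\<Prod>v\<in>V. 1 - (\<Sum>e\<in>s. c v e)))"
  using assms(1,3)
proof (induction V arbitrary: A rule: finite_induct)
  case empty
  then show ?case
    using assms(2) by (simp add: sum_power_card_supersets)
next
  case (insert v V)
  define g where "g = (\<lambda>s. x ^ card s * (\<Prod>v\<in>V. 1 - (\<Sum>e\<in>s. c v e)))"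
  have fin: "finite {s. B \<subseteq> s \<and> s \<subseteq> E}" for B
    by (rule finite_subset[of _ "Pow E"]) (use assms(2) in auto)
  \<comment> \<open>Summing over \<open>e\<close> first leaves, for each \<open>e\<close>, the sum over the sets that also contain \<open>e\<close>.\<close>
  have "(\<Sum>s | A \<subseteq> s \<and> s \<subseteq> E. g s * (\<Sum>e\<in>s. c v e))
      = (\<Sum>s | A \<subseteq> s \<and> s \<subseteq> E. \<Sum>e | e \<in> E \<and> e \<in> s. g s * c v e)"
    by (rule sum.cong) (auto simp: sum_distrib_left intro!: sum.cong)
  also have "\<dots> = (\<Sum>e\<in>E. \<Sum>s | s \<in> {s. A \<subseteq> s \<and> s \<subseteq> E} \<and> e \<in> s. g s * c v e)"
    by (rule sum.swap_restrict) (use fin assms(2) in auto)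
  also have "\<dots> = (\<Sum>e\<in>E. c v e * (\<Sum>s | insert e A \<subseteq> s \<and> s \<subseteq> E. g s))"
    by (rule sum.cong) (auto simp: sum_distrib_left mult.commute intro!: sum.cong)
  finally have split: "(\<Sum>s | A \<subseteq> s \<and> s \<subseteq> E. g s * (\<Sum>e\<in>s. c v e))
      = (\<Sum>e\<in>E. c v e * (\<Sum>s | insert e A \<subseteq> s \<and> s \<subseteq> E. g s))" .
  let ?n = "card E - card A - card (insert v V)"
  have "(1 + x) ^ ?n dvd (\<Sum>s | A \<subseteq> s \<and> s \<subseteq> E. g s)"
    unfolding g_def
    by (rule dvd_trans[OF le_imp_power_dvd insert.IH[OF insert.prems]])
      (use insert.hyps in simp)
  moreover have "(1 + x) ^ ?n dvd (\<Sum>s | insert e A \<subseteq> s \<and> s \<subseteq> E. g s)" if "e \<in> E" for e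
  proof -
    \<comment> \<open>The vertex removed from \<open>insert v V\<close> pays for the edge added to \<open>A\<close>.\<close>
    have "?n \<le> card E - card (insert e A) - card V"
      using insert.hyps card_insert_le_m1[of "Suc (card A)" A e] by simp
    then show ?thesis
      unfolding g_def
      by (rule dvd_trans[OF le_imp_power_dvd insert.IH]) (use that insert.prems in simp)
  qed
  ultimately have "(1 + x) ^ ?n dvd
      (\<Sum>s | A \<subseteq> s \<and> s \<subseteq> E. g s) - (\<Sum>s | A \<subseteq> s \<and> s \<subseteq> E. g s * (\<Sum>e\<in>s. c v e))"
    unfolding split by (intro dvd_diff dvd_sum[OF dvd_mult])
  also have "\<dots> = (\<Sum>s | A \<subseteq> s \<and> s \<subseteq> E. g s * (1 - (\<Sum>e\<in>s. c v e)))"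
    by (simp add: sum_subtractf algebra_simps)
  also have "\<dots> = (\<Sum>s | A \<subseteq> s \<and> s \<subseteq> E.
      x ^ card s * (\<Prod>v\<in>insert v V. 1 - (\<Sum>e\<in>s. c v e)))"
    using insert.hyps by (simp add: g_def mult_ac)
  finally show ?case .
qed

corollary power_dvd_subset_sum_prod:
  fixes x :: "'a :: comm_ring_1" and c :: "'v \<Rightarrow> 'e \<Rightarrow> 'a"
  assumes "finite V" "finite E"
  shows "(1 + x) ^ (card E - card V) dvd
    (\<Sum>s\<in>Pow E. x ^ card s * (\<Prod>v\<in>V. 1 - (\<Sum>e\<in>s. c v e)))"
  using power_dvd_superset_sum_prod[OF assms, of "{}" x c] by (simp add: Pow_def)

lemma map_poly_of_int_add:
  "map_poly of_int (p + q) = (map_poly of_int p + map_poly of_int q :: 'a :: comm_ring_1 poly)"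
  by (rule poly_eqI) (simp add: coeff_map_poly)

lemma map_poly_of_int_mult:
  "map_poly of_int (p * q) = (map_poly of_int p * map_poly of_int q :: 'a :: comm_ring_1 poly)"
  by (rule poly_eqI) (simp add: coeff_map_poly coeff_mult)

lemma map_poly_of_int_power:
  "map_poly of_int (p ^ n) = (map_poly of_int p ^ n :: 'a :: comm_ring_1 poly)"
  by (induction n) (simp_all add: map_poly_of_int_mult)

lemma poly_map_poly_of_int_prod:
  "poly (map_poly of_int (\<Prod>v\<in>A. g v)) x = (\<Prod>v\<in>A. poly (map_poly of_int (g v)) (x :: 'a :: comm_ring_1))"
  by (induction A rule: infinite_finite_induct) (simp_all add: map_poly_of_int_mult)

lemma to_fract_power: "to_fract (p ^ n) = to_fract p ^ n"
  by (induction n) simp_all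

lemma poly_f_poly_double_root:
  "poly (map_poly of_int (f_poly n)) (2 * \<i>) = \<i> ^ n * of_int (1 - int n)"
  by (induction n rule: f_poly.induct)
    (simp_all add: map_poly_of_int_add map_poly_of_int_mult map_poly_pCons algebra_simps)

lemma (in fin_multigraph) sum_deg_in:
  assumes "s \<subseteq> E"
  shows "(\<Sum>v\<in>V. deg_in ends s v) = 2 * card s"
proof -
  have "(\<Sum>v\<in>V. deg_in ends s v) = (\<Sum>e\<in>s. \<Sum>v\<in>V. count (ends e) v)"
    unfolding deg_in_def by (rule sum.swap)
  also have "\<dots> = (\<Sum>e\<in>s. 2)"
  proof (rule sum.cong)
    fix e assume "e \<in> s"
    then have "e \<in> E"
      using assms by blast
    have "(\<Sum>v\<in>V. count (ends e) v) = size (ends e)"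
      unfolding size_multiset_overloaded_eq
      by (rule sum.mono_neutral_right)
        (use \<open>e \<in> E\<close> finite_V ends_in_V in \<open>auto simp: not_in_iff\<close>)
    then show "(\<Sum>v\<in>V. count (ends e) v) = 2"
      using \<open>e \<in> E\<close> by (simp add: size_ends)
  qed simp
  finally show ?thesis
    by simp
qed

text \<open>
  The powers \<open>\<i>\<close> to the \<open>d\<^sub>v(s)\<close> multiply to \<open>\<i>\<close> to the \<open>2\<bar>s\<bar>\<close>, so the imaginary unit disappears and an
  integer remains.
\<close>

lemma (in fin_multigraph) prod_f_poly_double_root:
  assumes "s \<subseteq> E"
  shows "poly (map_poly of_int (\<Prod>v\<in>V. f_poly (deg_in ends s v))) (2 * \<i>)
    = of_int ((- 1) ^ card s * (\<Prod>v\<in>V. 1 - int (deg_in ends s v)))"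
  by (simp add: poly_map_poly_of_int_prod poly_f_poly_double_root prod.distrib
      flip: power_sum)
    (simp add: sum_deg_in[OF assms] power_mult)

lemma coeff_subst_gamma:
  "coeff (subst_gamma c P) n = poly (map_poly of_int (coeff P n)) c"
  by (simp add: subst_gamma_def coeff_map_poly)

lemma (in fin_multigraph) subst_gamma_theta:
  "subst_gamma (2 * \<i>) (theta V E ends) = map_poly of_int
    (\<Sum>s\<in>Pow E. [:0, -1:] ^ card s * (\<Prod>v\<in>V. 1 - (\<Sum>e\<in>s. of_nat (count (ends e) v))))"
    (is "?L = map_poly of_int ?R")
proof (rule poly_eqI)
  fix n
  have eval_sum: "poly (map_poly of_int (\<Sum>s\<in>S. g s)) c = (\<Sum>s\<in>S. poly (map_poly of_int (g s)) c)"
    for S :: "'b set" and g and c :: complex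
    by (induction S rule: infinite_finite_induct) (simp_all add: map_poly_of_int_add)
  have monom: "[:0, -1:] ^ card s * (\<Prod>v\<in>V. 1 - (\<Sum>e\<in>s. of_nat (count (ends e) v)))
      = monom ((- 1) ^ card s * (\<Prod>v\<in>V. 1 - int (deg_in ends s v))) (card s)" for s
  proof -
    have minus_beta: "[:0, -1:] = (monom (- 1) 1 :: int poly)"
      by (simp add: monom_altdef)
    have factor: "1 - (\<Sum>e\<in>s. of_nat (count (ends e) v)) = [:1 - int (deg_in ends s v):]" for v
    proof -
      have "(\<Sum>e\<in>s. of_nat (count (ends e) v)) = (of_nat (deg_in ends s v) :: int poly)"
        by (simp add: deg_in_def)
      then show ?thesis
        by (simp add: of_nat_poly one_pCons)
    qed
    have product: "(\<Prod>v\<in>V. [:1 - int (deg_in ends s v):]) = [:\<Prod>v\<in>V. 1 - int (deg_in ends s v):]"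
      by (induction V rule: infinite_finite_induct) (simp_all add: one_pCons mult.commute)
    show ?thesis
      unfolding minus_beta factor product by (simp add: monom_power smult_monom)
  qed
  have "coeff ?L n = (\<Sum>s\<in>Pow E. poly (map_poly of_int
      (coeff (monom (\<Prod>v\<in>V. f_poly (deg_in ends s v)) (card s)) n)) (2 * \<i>))"
    by (simp add: coeff_subst_gamma theta_def coeff_sum eval_sum)
  also have "\<dots> = (\<Sum>s\<in>Pow E. of_int
      (coeff (monom ((- 1) ^ card s * (\<Prod>v\<in>V. 1 - int (deg_in ends s v))) (card s)) n))"
    by (rule sum.cong) (auto simp: prod_f_poly_double_root)
  also have "\<dots> = coeff (map_poly of_int ?R) n"
    unfolding monom by (simp add: coeff_map_poly coeff_sum)
  finally show "coeff ?L n = coeff (map_poly of_int ?R) n" .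
qed

theorem theorem6:
  fixes V :: "'v set" and E :: "'e set" and ends :: "'e \<Rightarrow> 'v multiset"
  assumes "fin_multigraph V E ends"
  shows "\<exists>p :: int poly. omega V E ends = to_fract (map_poly of_int p)"
proof -
  interpret fin_multigraph V E ends
    by (fact assms)
  define q :: "int poly" where
    "q = (\<Sum>s\<in>Pow E. [:0, -1:] ^ card s * (\<Prod>v\<in>V. 1 - (\<Sum>e\<in>s. of_nat (count (ends e) v))))"
  have omega: "omega V E ends = to_fract (map_poly of_int q)
      / to_fract [:1, -1:] powi (int (card E) - int (card V))"
    by (simp add: omega_def subst_gamma_theta q_def)
  have base: "map_poly of_int [:1, -1:] = ([:1, -1:] :: complex poly)"
    by (simp add: map_poly_pCons)
  have nonzero: "to_fract ([:1, -1:] :: complex poly) \<noteq> 0"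
    by simp
  have "[:1, -1:] = 1 + ([:0, -1:] :: int poly)"
    by (simp add: one_pCons)
  then have "[:1, -1:] ^ (card E - card V) dvd q"
    unfolding q_def using power_dvd_subset_sum_prod[OF finite_V finite_E, of "[:0, -1:]"]
    by simp
  then obtain r where r: "q = [:1, -1:] ^ (card E - card V) * r"
    by (elim dvdE)
  show ?thesis
  proof (cases "card V \<le> card E")
    case True
    then have "omega V E ends = to_fract (map_poly of_int r)"
      using nonzero
      by (simp add: omega r map_poly_of_int_mult map_poly_of_int_power base to_fract_power power_int_def
          nat_diff_distrib flip: of_nat_diff)
    then show ?thesis ..
  next
    case False
    then have "omega V E ends = to_fract (map_poly of_int (q * [:1, -1:] ^ (card V - card E)))"
      using nonzero
      by (simp add: omega map_poly_of_int_mult map_poly_of_int_power base to_fract_power power_int_def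
          nat_diff_distrib field_simps)
    then show ?thesis ..
  qed
qed

end
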